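(* For all integers $m,n\ge 1$, $$\Omega_H(G_{m,n})=\Omega_V(G_{m,n})=F(m,n).$$
   Context: $G_{m,n}=P_m\square P_n$ is the rectangular grid graph with $m$ rows and $n$ columns: vertices $v_{i,j}$ with $1\le i\le m$, $1\le j\le n$; horizontal edges join $v_{i,j}$ and $v_{i,j+1}$ (same row), vertical edges join $v_{i,j}$ and $v_{i+1,j}$ (same column). A feasible representative pair in a graph $G$ is a pair $(T,M)$ where $M$ is a matching of $G$ (a set of pairwise vertex-disjoint edges, possibly empty), $V(M)$ is the set of endpoints of edges of $M$, $T\subseteq V(G)$ is disjoint from $V(M)$, and every $t\in T$ has at most one neighbor in $T\cup V(M)$. $\Omega_H(G_{m,n})$ (respectively $\Omega_V(G_{m,n})$) is the maximum of $|T|+|M|$ over all feasible representative pairs $(T,M)$ in $G_{m,n}$ such that every edge of $M$ is horizontal (respectively vertical). Finally $$F(m,n)=\max\left\{\left\lceil\tfrac m2\right\rceil\left\lceil\tfrac{2n}3\right\rceil+\left\lfloor\tfrac m2\right\rfloor\left\lfloor\tfrac n3\right\rfloor,\ \left\lceil\tfrac n2\right\rceil\left\lceil\tfrac{2m}3\right\rceil+\left\lfloor\tfrac n2\right\rfloor\left\lfloor\tfrac m3\right\rfloor\right\}.$$ *)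

theory Defs
  imports Complex_Main
begin

text \<open>
  A simple graph is given by a vertex set \<open>V\<close> and a set \<open>E\<close> of two-element sets of vertices;
  the vertex \<open>v\<^sub>i\<^sub>,\<^sub>j\<close> of the grid is the pair \<open>(i, j)\<close> (row, column).
\<close>

definition horizontal_edges :: "nat \<Rightarrow> nat \<Rightarrow> (nat \<times> nat) set set" where
  "horizontal_edges m n = {{(i, j), (i, j + 1)} | i j. 1 \<le> i \<and> i \<le> m \<and> 1 \<le> j \<and> j + 1 \<le> n}"

definition vertical_edges :: "nat \<Rightarrow> nat \<Rightarrow> (nat \<times> nat) set set" where
  "vertical_edges m n = {{(i, j), (i + 1, j)} | i j. 1 \<le> i \<and> i + 1 \<le> m \<and> 1 \<le> j \<and> j \<le> n}"

definition grid_vertices :: "nat \<Rightarrow> nat \<Rightarrow> (nat \<times> nat) set" where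
  "grid_vertices m n = {1..m} \<times> {1..n}"

definition grid_edges :: "nat \<Rightarrow> nat \<Rightarrow> (nat \<times> nat) set set" where
  "grid_edges m n = horizontal_edges m n \<union> vertical_edges m n"

definition matching :: "'a set set \<Rightarrow> 'a set set \<Rightarrow> bool" where
  "matching E M \<longleftrightarrow> M \<subseteq> E \<and> (\<forall>e\<in>M. \<forall>f\<in>M. e \<noteq> f \<longrightarrow> e \<inter> f = {})"

text \<open>The set of endpoints \<open>V(M)\<close> is \<open>\<Union>M\<close>.\<close>

definition feasible_pair :: "'a set \<Rightarrow> 'a set set \<Rightarrow> 'a set \<Rightarrow> 'a set set \<Rightarrow> bool" where
  "feasible_pair V E T M \<longleftrightarrow>
     matching E M \<and> T \<subseteq> V \<and> T \<inter> \<Union>M = {} \<and>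
     (\<forall>t\<in>T. \<exists>\<^sub>\<le>\<^sub>1u. u \<in> T \<union> \<Union>M \<and> {t, u} \<in> E)"

definition Omega_H :: "nat \<Rightarrow> nat \<Rightarrow> nat" where
  "Omega_H m n = Max {card T + card M | T M.
     feasible_pair (grid_vertices m n) (grid_edges m n) T M \<and> M \<subseteq> horizontal_edges m n}"

definition Omega_V :: "nat \<Rightarrow> nat \<Rightarrow> nat" where
  "Omega_V m n = Max {card T + card M | T M.
     feasible_pair (grid_vertices m n) (grid_edges m n) T M \<and> M \<subseteq> vertical_edges m n}"

definition F :: "nat \<Rightarrow> nat \<Rightarrow> int" where
  "F m n = max
     (\<lceil>real m / 2\<rceil> * \<lceil>2 * real n / 3\<rceil> + \<lfloor>real m / 2\<rfloor> * \<lfloor>real n / 3\<rfloor>)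
     (\<lceil>real n / 2\<rceil> * \<lceil>2 * real m / 3\<rceil> + \<lfloor>real n / 2\<rfloor> * \<lfloor>real m / 3\<rfloor>)"

text \<open>The maxima are taken over finite nonempty sets, so \<open>Max\<close> is meaningful.\<close>

lemma finite_grid_vertices: "finite (grid_vertices m n)"
  by (simp add: grid_vertices_def)

lemma grid_edges_subset: "grid_edges m n \<subseteq> Pow (grid_vertices m n)"
  by (auto simp: grid_edges_def horizontal_edges_def vertical_edges_def grid_vertices_def)

lemma finite_feasible_sizes:
  "finite {card T + card M | T M.
     feasible_pair (grid_vertices m n) (grid_edges m n) T M \<and> P M}"
proof (rule finite_subset)
  show "{card T + card M | T M. feasible_pair (grid_vertices m n) (grid_edges m n) T M \<and> P M}
    \<subseteq> (\<lambda>(T, M). card T + card M) ` (Pow (grid_vertices m n) \<times> Pow (grid_edges m n))"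
    by (auto simp: feasible_pair_def matching_def image_iff)
  have "finite (grid_edges m n)"
    using finite_subset[OF grid_edges_subset] finite_grid_vertices by simp
  then show "finite ((\<lambda>(T, M). card T + card M) `
      (Pow (grid_vertices m n) \<times> Pow (grid_edges m n)))"
    using finite_grid_vertices by simp
qed

lemma feasible_pair_empty: "feasible_pair V E {} {}"
  by (simp add: feasible_pair_def matching_def)

end

theory Submission
  imports Defs
begin

text \<open>
  Both maxima equal the larger of \<open>stripwise_bound m n\<close> and \<open>stripwise_bound n m\<close>. Here
  \<open>stripwise_bound m n\<close> is what one gets by cutting the \<open>m\<close> rows into pairs, allowing an average
  of one half per cell in each pair, and letting a single left-over row (if \<open>m\<close> is odd) carry
  two thirds of its cells. Each term of \<open>F\<close> simplifies to such a number.

  The lower bound uses no matching at all: the vertices of the odd rows outside the columns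
  divisible by 3, together with those of the even rows inside these columns, induce a subgraph
  of maximum degree 1, and there are \<open>stripwise_bound m n\<close> of them. The transposed set gives the
  other number. Transposition also exchanges horizontal and vertical matchings, so the upper
  bound is only needed for horizontal ones.

  For the upper bound, the value 1 of a matching edge is placed on its left endpoint. The total
  is then the number of cells that are in \<open>T\<close> or are left endpoints, and since edges do not leave
  their row, every set of rows can be studied on its own. A single row carries at most
  two thirds of its cells, rounded up (\<open>row_weight_le\<close>). The heart of the proof is the study of two
  consecutive rows of length \<open>n\<close>:

    \<^item> for even \<open>n\<close> they carry at most \<open>n\<close>;
    \<^item> for odd \<open>n\<close> they carry at most \<open>n + 1\<close>, and if they carry \<open>n + 1\<close> then both cells of every
      odd column belong to \<open>T\<close>.

  For even \<open>n\<close> the first fact, with one single row if \<open>m\<close> is odd, is enough. For odd \<open>n\<close> call a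
  pair of rows with weight \<open>n + 1\<close> heavy. The rows next to a heavy pair are unoccupied in
  all odd columns, hence light. So adjacent pairs are not both heavy, and two heavy pairs at
  distance two enclose a pair that is light enough to pay for one of them. Among three
  consecutive pairs the excess over \<open>n\<close> per pair is therefore at most 1 in total, which settles
  even \<open>m\<close>. If \<open>m\<close> is odd too, look at the last two rows: if they are not heavy, remove them and
  use induction; if they are heavy, the row before them carries at most \<open>n div 2\<close>, and the
  remaining \<open>m - 3\<close> rows fall under the even case.
\<close>

section \<open>Occupied cells of the grid\<close>

definition grid_adj :: "nat \<times> nat \<Rightarrow> nat \<times> nat \<Rightarrow> bool" where
  "grid_adj u v \<longleftrightarrow>
     fst u = fst v \<and> (snd v = Suc (snd u) \<or> snd u = Suc (snd v)) \<or>
     snd u = snd v \<and> (fst v = Suc (fst u) \<or> fst u = Suc (fst v))"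

text \<open>
  The predicate \<open>L\<close> marks the left endpoints of the matching edges; it determines a horizontal
  matching, whose right endpoints are the cells directly to the right of the marked ones.
\<close>

definition occupied :: "(nat \<Rightarrow> nat \<Rightarrow> bool) \<Rightarrow> (nat \<Rightarrow> nat \<Rightarrow> bool) \<Rightarrow> nat \<times> nat \<Rightarrow> bool" where
  "occupied T L = (\<lambda>(i, j). T i j \<or> L i j \<or> (\<exists>k. j = Suc k \<and> L i k))"

text \<open>
  Feasible pairs with a horizontal matching, without reference to the size of the grid. Hence
  any block of rows and any prefix of columns can be examined inside the same pair.
\<close>

locale horizontal_pair =
  fixes T L :: "nat \<Rightarrow> nat \<Rightarrow> bool"
  assumes left_not_T: "L i j \<Longrightarrow> \<not> T i j"
    and right_not_T: "L i j \<Longrightarrow> \<not> T i (Suc j)"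
    and right_not_left: "L i j \<Longrightarrow> \<not> L i (Suc j)"
    and degree_le_1: "T i j \<Longrightarrow> grid_adj (i, j) u \<Longrightarrow> grid_adj (i, j) v \<Longrightarrow>
          occupied T L u \<Longrightarrow> occupied T L v \<Longrightarrow> u = v"
begin

abbreviation occ :: "nat \<Rightarrow> nat \<Rightarrow> bool" where
  "occ i j \<equiv> occupied T L (i, j)"

lemma occI: "T i j \<Longrightarrow> occ i j" "L i j \<Longrightarrow> occ i j" "L i j \<Longrightarrow> occ i (Suc j)"
  by (auto simp: occupied_def)

lemma T_left_right: "T i (Suc j) \<Longrightarrow> \<not> (occ i j \<and> occ i (Suc (Suc j)))"
  using degree_le_1[of i "Suc j" "(i, j)" "(i, Suc (Suc j))"] by (auto simp: grid_adj_def)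

lemma T_up_down: "T (Suc i) j \<Longrightarrow> \<not> (occ i j \<and> occ (Suc (Suc i)) j)"
  using degree_le_1[of "Suc i" j "(i, j)" "(Suc (Suc i), j)"] by (auto simp: grid_adj_def)

text \<open>
  Within a \<open>2 \<times> 2\<close> block, the two neighbours of a cell of \<open>T\<close> are not both occupied. The four
  parts are the four positions of that cell.
\<close>

lemma T_square:
  "T i j \<Longrightarrow> \<not> (occ i (Suc j) \<and> occ (Suc i) j)"
  "T i (Suc j) \<Longrightarrow> \<not> (occ i j \<and> occ (Suc i) (Suc j))"
  "T (Suc i) j \<Longrightarrow> \<not> (occ (Suc i) (Suc j) \<and> occ i j)"
  "T (Suc i) (Suc j) \<Longrightarrow> \<not> (occ (Suc i) j \<and> occ i (Suc j))"
  using degree_le_1[of i j "(i, Suc j)" "(Suc i, j)"]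
    degree_le_1[of i "Suc j" "(i, j)" "(Suc i, Suc j)"]
    degree_le_1[of "Suc i" j "(Suc i, Suc j)" "(i, j)"]
    degree_le_1[of "Suc i" "Suc j" "(Suc i, j)" "(i, Suc j)"]
  by (auto simp: grid_adj_def)

text \<open>
  Putting the whole value of an edge on its left endpoint keeps all weights integral, and the
  weight of the first \<open>n\<close> columns then does not depend on what follows. The price is that a
  left endpoint in column \<open>n\<close> must be treated with care; see \<open>overhang\<close> below.
\<close>

definition weight :: "nat \<Rightarrow> nat \<Rightarrow> nat" where
  "weight i j = of_bool (T i j \<or> L i j)"

definition row_weight :: "nat \<Rightarrow> nat \<Rightarrow> nat" where
  "row_weight n i = (\<Sum>j=1..n. weight i j)"

definition strip_weight :: "nat \<Rightarrow> nat \<Rightarrow> nat" where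
  "strip_weight n i = row_weight n i + row_weight n (Suc i)"

lemma weight_le_1: "weight i j \<le> 1"
  by (simp add: weight_def)

lemma row_weight_Suc: "row_weight (Suc n) i = row_weight n i + weight i (Suc n)"
  by (simp add: row_weight_def)

section \<open>One row\<close>

text \<open>
  A left endpoint is followed by a right endpoint, which has weight 0. So three consecutive cells
  of weight 1 would begin with two cells of \<open>T\<close>, and the second of them would have two occupied
  neighbours.
\<close>

lemma three_in_row:
  "weight i (Suc j) + weight i (Suc (Suc j)) + weight i (Suc (Suc (Suc j))) \<le> 2"
proof (rule ccontr)
  assume "\<not> ?thesis"
  then have all: "T i c \<or> L i c" if "c \<in> {Suc j, Suc (Suc j), Suc (Suc (Suc j))}" for c
    using that by (auto simp: weight_def of_bool_def split: if_splits)
  then have "T i (Suc j)" "T i (Suc (Suc j))"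
    using right_not_T[of i "Suc j"] right_not_left[of i "Suc j"]
      right_not_T[of i "Suc (Suc j)"] right_not_left[of i "Suc (Suc j)"] by auto
  then show False
    using all T_left_right[of i "Suc j"] occI by blast
qed

lemma row_weight_le: "row_weight n i \<le> (2 * n + 2) div 3"
proof (induction n rule: less_induct)
  case (less n)
  consider "n = 0" | "n = 1" | "n = 2" | k where "n = Suc (Suc (Suc k))"
    by (metis One_nat_def Suc_1 not0_implies_Suc)
  then show ?case
  proof cases
    case 2 then show ?thesis using weight_le_1[of i 1] by (simp add: row_weight_def)
  next
    case 3
    then have "n = Suc (Suc 0)" by simp
    then show ?thesis using weight_le_1[of i "Suc 0"] weight_le_1[of i "Suc (Suc 0)"]
      by (simp add: row_weight_def)
  next
    case (4 k)
    then show ?thesis using less.IH[of k] three_in_row[of i k] by (simp add: row_weight_Suc)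
  qed (simp add: row_weight_def)
qed

section \<open>Two consecutive rows\<close>

definition column_weight :: "nat \<Rightarrow> nat \<Rightarrow> nat" where
  "column_weight i j = weight i j + weight (Suc i) j"

lemma strip_weight_Suc:
  "strip_weight (Suc n) i = strip_weight n i + column_weight i (Suc n)"
  by (simp add: strip_weight_def row_weight_Suc column_weight_def)

lemma column_weight_le_2: "column_weight i j \<le> 2"
  using weight_le_1[of i j] weight_le_1[of "Suc i" j] by (simp add: column_weight_def)

text \<open>
  A column of weight 2 in which some edge sticks out to the right. This is the only way in which
  a prefix of even length can weigh more than its number of columns: the edge has been paid for in
  full although half of it lies outside the prefix.
\<close>

definition overhang :: "nat \<Rightarrow> nat \<Rightarrow> bool" where
  "overhang i j \<longleftrightarrow> column_weight i j = 2 \<and> \<not> (T i j \<and> T (Suc i) j)"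

lemma column_weight_eq_2:
  "column_weight i j = 2 \<longleftrightarrow> (T i j \<or> L i j) \<and> (T (Suc i) j \<or> L (Suc i) j)"
  by (auto simp: column_weight_def weight_def)

lemma column_weight_eq_0:
  "\<not> occ i j \<Longrightarrow> \<not> occ (Suc i) j \<Longrightarrow> column_weight i j = 0"
  by (auto simp: column_weight_def weight_def dest: occI)

text \<open>
  To the right of a left endpoint there is a right endpoint; to the right of a cell of \<open>T\<close> there
  is nothing, because that cell already has its occupied neighbour in its own column.
\<close>

lemma column_after_full_column:
  assumes "column_weight i j = 2"
  shows "column_weight i (Suc j) = 0"
proof -
  have "T i j \<or> L i j" "T (Suc i) j \<or> L (Suc i) j"
    using assms by (simp_all add: column_weight_eq_2)
  then have "\<not> T i (Suc j)" "\<not> L i (Suc j)" "\<not> T (Suc i) (Suc j)" "\<not> L (Suc i) (Suc j)"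
    using T_square(1,3)[of i j] right_not_T right_not_left occI by blast+
  then show ?thesis by (simp add: column_weight_def weight_def)
qed

text \<open>The two cells of \<open>T\<close> are each other's only occupied neighbour.\<close>

lemma column_before_T_column:
  assumes "T i (Suc j)" "T (Suc i) (Suc j)"
  shows "\<not> occ i j" "\<not> occ (Suc i) j"
  using T_square(2,4)[of i j] assms occI(1) by blast+

text \<open>
  The inductive step for prefixes of even length. Two columns add at most 2, unless a column of
  weight 1 precedes one of weight 2; the latter then does not lie in \<open>T\<close> entirely, so there is
  an overhang at the end. An overhang at the beginning forces a column of weight 0 that
  contains a right endpoint. Again this excludes a column of two cells of \<open>T\<close> after it, so if
  the second column has weight 2, the overhang is passed on.
\<close>

lemma block_step:
  "of_bool (overhang i j) + column_weight i (Suc j) + column_weight i (Suc (Suc j))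
    \<le> 2 + of_bool (overhang i (Suc (Suc j)))"
proof (cases "overhang i j")
  case True
  then have empty: "column_weight i (Suc j) = 0"
    using column_after_full_column by (simp add: overhang_def)
  have "overhang i (Suc (Suc j))" if full: "column_weight i (Suc (Suc j)) = 2"
  proof (rule ccontr)
    assume "\<not> overhang i (Suc (Suc j))"
    then have "\<not> occ i (Suc j)" "\<not> occ (Suc i) (Suc j)"
      using full column_before_T_column[of i "Suc j"] by (auto simp: overhang_def)
    then show False using True occI(3) by (auto simp: overhang_def column_weight_eq_2)
  qed
  then show ?thesis using empty column_weight_le_2[of i "Suc (Suc j)"] by fastforce
next
  case False
  show ?thesis
  proof (cases "column_weight i (Suc j) = 2")
    case True
    then show ?thesis using False column_after_full_column by simp
  next
    case not_full: False
    have "overhang i (Suc (Suc j))"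
      if "column_weight i (Suc j) \<noteq> 0" "column_weight i (Suc (Suc j)) = 2"
      using that column_before_T_column[of i "Suc j"] column_weight_eq_0[of i "Suc j"]
      by (auto simp: overhang_def)
    then show ?thesis using False not_full
        column_weight_le_2[of i "Suc j"] column_weight_le_2[of i "Suc (Suc j)"] by fastforce
  qed
qed

lemma strip_weight_even_prefix: "strip_weight (2 * k) i \<le> 2 * k + of_bool (overhang i (2 * k))"
proof (induction k)
  case 0
  show ?case by (simp add: strip_weight_def row_weight_def)
next
  case (Suc k)
  then show ?case using block_step[of i "2 * k"] by (simp add: strip_weight_Suc)
qed

lemma overhang_no_L: "\<not> L i j \<Longrightarrow> \<not> L (Suc i) j \<Longrightarrow> \<not> overhang i j"
  by (auto simp: overhang_def column_weight_eq_2)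

text \<open>No edge of the matching crosses the right border of the grid, so the overhang disappears.\<close>

lemma strip_weight_even:
  assumes "even n" "\<not> L i n" "\<not> L (Suc i) n"
  shows "strip_weight n i \<le> n"
proof -
  obtain k where "n = 2 * k" using assms(1) by auto
  then show ?thesis
    using strip_weight_even_prefix[of k i] overhang_no_L[OF assms(2,3)] by simp
qed

lemma strip_weight_odd:
  "strip_weight (Suc (2 * k)) i \<le> 2 * k + 2"
proof (cases "overhang i (2 * k)")
  case True
  then have "column_weight i (Suc (2 * k)) = 0"
    using column_after_full_column by (simp add: overhang_def)
  then show ?thesis using strip_weight_even_prefix[of k i] True by (simp add: strip_weight_Suc)
next
  case False
  then show ?thesis
    using strip_weight_even_prefix[of k i] column_weight_le_2[of i "Suc (2 * k)"]
    by (simp add: strip_weight_Suc)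
qed

lemma heavy_strip_last_column:
  assumes "\<not> L i (Suc (2 * k))" "\<not> L (Suc i) (Suc (2 * k))"
    and "strip_weight (Suc (2 * k)) i = 2 * k + 2"
  shows "T i (Suc (2 * k))" "T (Suc i) (Suc (2 * k))"
proof -
  have "column_weight i (Suc (2 * k)) = 2"
  proof (rule ccontr)
    assume "column_weight i (Suc (2 * k)) \<noteq> 2"
    then have "overhang i (2 * k)" "column_weight i (Suc (2 * k)) \<noteq> 0"
      using assms(3) strip_weight_even_prefix[of k i] column_weight_le_2[of i "Suc (2 * k)"]
      by (cases "overhang i (2 * k)"; simp add: strip_weight_Suc)+
    then show False using column_after_full_column by (simp add: overhang_def)
  qed
  then show "T i (Suc (2 * k))" "T (Suc i) (Suc (2 * k))"
    using assms(1,2) by (auto simp: column_weight_eq_2)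
qed

text \<open>
  Going backwards from the last column: a heavy prefix of odd length ends with a column of two
  cells of \<open>T\<close>, so the column before it is unoccupied. Removing both columns removes weight 2
  and leaves a heavy prefix, across whose right border no edge sticks out.
\<close>

lemma heavy_strip_columns:
  assumes "\<not> L i (Suc (2 * k))" "\<not> L (Suc i) (Suc (2 * k))"
    and "strip_weight (Suc (2 * k)) i = 2 * k + 2" "l \<le> k"
  shows "T i (Suc (2 * l)) \<and> T (Suc i) (Suc (2 * l))"
  using assms
proof (induction k)
  case 0
  then show ?case using heavy_strip_last_column[of i 0] by simp
next
  case (Suc k)
  let ?j = "2 * Suc k"
  note last = heavy_strip_last_column[OF Suc.prems(1-3)]
  note empty = column_before_T_column[OF last]
  have "column_weight i ?j = 0"
    by (rule column_weight_eq_0[OF empty])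
  then have "strip_weight (Suc (2 * k)) i = 2 * k + 2"
    using Suc.prems(3) strip_weight_odd[of k i] column_weight_le_2[of i "Suc ?j"]
    by (simp add: strip_weight_Suc)
  moreover have "\<not> L i (Suc (2 * k))" "\<not> L (Suc i) (Suc (2 * k))"
    using empty occI(3)[of i "Suc (2 * k)"] occI(3)[of "Suc i" "Suc (2 * k)"] by auto
  ultimately show ?case
    using Suc.IH Suc.prems(4) last by (cases "l = Suc k") auto
qed

section \<open>Rows next to a heavy pair of rows\<close>

lemma row_weight_of_even_columns:
  assumes "\<And>l. l \<le> k \<Longrightarrow> \<not> occ i (Suc (2 * l))"
  shows "row_weight (Suc (2 * k)) i \<le> k"
  using assms
proof (induction k)
  case 0
  then show ?case using occI[of i 1] by (auto simp: row_weight_def weight_def)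
next
  case (Suc k)
  have "weight i (Suc (2 * Suc k)) = 0"
    using Suc.prems[of "Suc k"] occI[of i "Suc (2 * Suc k)"] by (auto simp: weight_def)
  then show ?case using Suc weight_le_1[of i "2 * Suc k"] by (simp add: row_weight_Suc)
qed

text \<open>
  Each cell of \<open>T\<close> in an odd column of a heavy pair of rows has its occupied neighbour inside the
  pair. So the odd columns of the adjacent rows are unoccupied.
\<close>

lemma row_below_heavy_strip:
  assumes "\<not> L i (Suc (2 * k))" "\<not> L (Suc i) (Suc (2 * k))"
    and "strip_weight (Suc (2 * k)) i = 2 * k + 2"
  shows "row_weight (Suc (2 * k)) (Suc (Suc i)) \<le> k"
proof (rule row_weight_of_even_columns)
  fix l assume "l \<le> k"
  then show "\<not> occ (Suc (Suc i)) (Suc (2 * l))"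
    using heavy_strip_columns[OF assms, of l] T_up_down[of i "Suc (2 * l)"] occI(1) by blast
qed

lemma row_above_heavy_strip:
  assumes "\<not> L (Suc i) (Suc (2 * k))" "\<not> L (Suc (Suc i)) (Suc (2 * k))"
    and "strip_weight (Suc (2 * k)) (Suc i) = 2 * k + 2"
  shows "row_weight (Suc (2 * k)) i \<le> k"
proof (rule row_weight_of_even_columns)
  fix l assume "l \<le> k"
  then show "\<not> occ i (Suc (2 * l))"
    using heavy_strip_columns[OF assms, of l] T_up_down[of i "Suc (2 * l)"] occI(1) by blast
qed

section \<open>The whole grid\<close>

definition total_weight :: "nat \<Rightarrow> nat \<Rightarrow> nat" where
  "total_weight m n = (\<Sum>i=1..m. row_weight n i)"

lemma total_weight_0: "total_weight 0 n = 0"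
  by (simp add: total_weight_def)

lemma total_weight_Suc: "total_weight (Suc m) n = total_weight m n + row_weight n (Suc m)"
  by (simp add: total_weight_def)

lemma total_weight_Suc_Suc:
  "total_weight (Suc (Suc m)) n = total_weight m n + strip_weight n (Suc m)"
  by (simp add: total_weight_def strip_weight_def)

lemma total_weight_even_width:
  assumes "even n" "\<And>i. \<not> L i n"
  shows "total_weight (2 * k) n \<le> k * n"
proof (induction k)
  case (Suc k)
  then show ?case using strip_weight_even[OF assms(1), of "Suc (2 * k)"] assms(2)
    by (simp add: total_weight_Suc_Suc)
qed (simp add: total_weight_0)

lemma two_strips:
  assumes "\<And>i. \<not> L i (Suc (2 * k))"
  shows "strip_weight (Suc (2 * k)) i + strip_weight (Suc (2 * k)) (Suc (Suc i)) \<le> 4 * k + 3"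
proof -
  let ?n = "Suc (2 * k)"
  have "strip_weight ?n i \<le> 2 * k + 2" "strip_weight ?n (Suc (Suc i)) \<le> 2 * k + 2"
    using strip_weight_odd by simp_all
  moreover have False
    if "strip_weight ?n i = 2 * k + 2" "strip_weight ?n (Suc (Suc i)) = 2 * k + 2"
  proof -
    have "T i 1" "T (Suc i) 1" "T (Suc (Suc i)) 1"
      using heavy_strip_columns[OF assms assms that(1), of 0]
        heavy_strip_columns[OF assms assms that(2), of 0] by simp_all
    then show False using T_up_down[of i 1] occI(1) by blast
  qed
  ultimately show ?thesis by fastforce
qed

text \<open>
  If the outer pairs of rows are both heavy, then each of the two rows between them is
  adjacent to a heavy pair.
\<close>

lemma three_strips:
  assumes "\<And>i. \<not> L i (Suc (2 * k))"
  shows "strip_weight (Suc (2 * k)) i + strip_weight (Suc (2 * k)) (Suc (Suc i))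
    + strip_weight (Suc (2 * k)) (Suc (Suc (Suc (Suc i)))) \<le> 6 * k + 4"
proof -
  let ?s = "strip_weight (Suc (2 * k))"
  let ?a = "?s i" and ?b = "?s (Suc (Suc i))" and ?c = "?s (Suc (Suc (Suc (Suc i))))"
  have le: "?s i' \<le> 2 * k + 2" for i'
    using strip_weight_odd by simp
  show ?thesis
  proof (cases "?a = 2 * k + 2 \<and> ?c = 2 * k + 2")
    case True
    then have "?b \<le> 2 * k"
      using row_below_heavy_strip[of i k] row_above_heavy_strip[of "Suc (Suc (Suc i))" k] assms
      by (simp add: strip_weight_def)
    then show ?thesis using True by simp
  next
    case False
    then show ?thesis using le[of i] le[of "Suc (Suc (Suc (Suc i)))"] two_strips[OF assms, of i]
        two_strips[OF assms, of "Suc (Suc i)"] by fastforce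
  qed
qed

text \<open>
  The excess \<open>(s + 2) div 3\<close> is \<open>s / 3\<close> rounded up: pairs of rows are taken in groups of three, and
  a last incomplete group also has excess at most 1.
\<close>

lemma total_weight_odd_width:
  assumes "\<And>i. \<not> L i (Suc (2 * k))"
  shows "total_weight (2 * s) (Suc (2 * k)) \<le> s * Suc (2 * k) + (s + 2) div 3"
proof (induction s rule: less_induct)
  case (less s)
  consider "s = 0" | "s = 1" | "s = 2" | p where "s = Suc (Suc (Suc p))"
    by (metis One_nat_def Suc_1 not0_implies_Suc)
  then show ?case
  proof cases
    case 1 then show ?thesis by (simp add: total_weight_0)
  next
    case 2
    have "2 * s = Suc (Suc 0)" using 2 by simp
    then show ?thesis
      using strip_weight_odd[of k 1] 2
      by (simp only: total_weight_Suc_Suc total_weight_0) simp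
  next
    case 3
    have "2 * s = Suc (Suc (Suc (Suc 0)))" using 3 by simp
    then show ?thesis
      using two_strips[OF assms, of 1] 3
      by (simp only: total_weight_Suc_Suc total_weight_0) simp
  next
    case (4 p)
    have "2 * s = Suc (Suc (Suc (Suc (Suc (Suc (2 * p))))))" using 4 by simp
    then have "total_weight (2 * s) (Suc (2 * k)) \<le> total_weight (2 * p) (Suc (2 * k)) + (6 * k + 4)"
      using three_strips[OF assms, of "Suc (2 * p)"]
      by (simp only: total_weight_Suc_Suc)
    then show ?thesis using less.IH[of p] 4 by (simp add: algebra_simps)
  qed
qed

end

text \<open>
  Each of the two expressions under the maximum in \<open>F\<close> equals such a bound; the number
  \<open>(2 * n + 2) div 3\<close> is \<open>2 * n / 3\<close> rounded up.
\<close>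

definition stripwise_bound :: "nat \<Rightarrow> nat \<Rightarrow> nat" where
  "stripwise_bound m n = (m div 2) * n + (if odd m then (2 * n + 2) div 3 else 0)"

context horizontal_pair
begin

text \<open>
  If the last two rows are not heavy, removing them lowers \<open>stripwise_bound m n\<close> by exactly \<open>n\<close> and
  \<open>stripwise_bound n m\<close> by at least \<open>n\<close>, so induction applies. If they are heavy, the rows
  split into an even number of rows, a row of weight at most \<open>n div 2\<close> and a pair of weight
  \<open>n + 1\<close>, which together give exactly \<open>stripwise_bound n m\<close>.
\<close>

lemma total_weight_odd_odd:
  assumes "\<And>i. \<not> L i (Suc (2 * k))"
  shows "total_weight (Suc (2 * p)) (Suc (2 * k)) \<le>
    max (stripwise_bound (Suc (2 * p)) (Suc (2 * k))) (stripwise_bound (Suc (2 * k)) (Suc (2 * p)))"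
proof (induction p)
  case 0
  show ?case using row_weight_le[of "Suc (2 * k)" 1]
    by (simp add: total_weight_Suc total_weight_0 stripwise_bound_def)
next
  case (Suc p)
  let ?n = "Suc (2 * k)" and ?i = "Suc (Suc (2 * p))"
  have split: "total_weight (Suc (2 * Suc p)) ?n = total_weight (Suc (2 * p)) ?n + strip_weight ?n ?i"
    by (simp add: total_weight_Suc_Suc)
  show ?case
  proof (cases "strip_weight ?n ?i \<le> ?n")
    case True
    have "stripwise_bound (Suc (2 * p)) ?n + ?n = stripwise_bound (Suc (2 * Suc p)) ?n"
      by (simp add: stripwise_bound_def)
    moreover have "stripwise_bound ?n (Suc (2 * p)) + ?n \<le> stripwise_bound ?n (Suc (2 * Suc p))"
      by (simp add: stripwise_bound_def)
    ultimately show ?thesis using Suc True split by linarith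
  next
    case False
    then have heavy: "strip_weight ?n ?i = 2 * k + 2"
      using strip_weight_odd[of k ?i] by simp
    have "row_weight ?n (Suc (2 * p)) \<le> k"
      using row_above_heavy_strip[OF _ _ heavy] assms by simp
    then have "total_weight (Suc (2 * Suc p)) ?n \<le>
        p * ?n + (p + 2) div 3 + k + (2 * k + 2)"
      using total_weight_odd_width[OF assms, of p] heavy split
      by (simp add: total_weight_Suc)
    also have "\<dots> = stripwise_bound ?n (Suc (2 * Suc p))"
      by (simp add: stripwise_bound_def algebra_simps)
    finally show ?thesis by simp
  qed
qed

lemma total_weight_le:
  assumes "\<And>i. \<not> L i n"
  shows "total_weight m n \<le> max (stripwise_bound m n) (stripwise_bound n m)"
proof (cases "even m")
  case m: True
  then obtain s where s: "m = 2 * s" by auto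
  show ?thesis
  proof (cases "even n")
    case True
    then show ?thesis using total_weight_even_width[OF True assms, of s] s
      by (simp add: stripwise_bound_def)
  next
    case False
    then obtain k where k: "n = Suc (2 * k)" by (auto elim: oddE)
    have "s * n + (s + 2) div 3 = stripwise_bound n m"
      by (simp add: stripwise_bound_def s k algebra_simps)
    then show ?thesis using total_weight_odd_width[of k s] assms s k by simp
  qed
next
  case False
  then obtain p where p: "m = Suc (2 * p)" by (auto elim: oddE)
  show ?thesis
  proof (cases "even n")
    case True
    then show ?thesis
      using total_weight_even_width[OF True assms, of p] row_weight_le[of n m]
      by (simp add: stripwise_bound_def total_weight_Suc p)
  next
    case False
    then obtain k where k: "n = Suc (2 * k)" by (auto elim: oddE)
    show ?thesis using total_weight_odd_odd[of k p] assms unfolding p k by simp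
  qed
qed

end

section \<open>From feasible pairs to occupied cells\<close>

lemma grid_edge_iff:
  "{u, v} \<in> grid_edges m n \<longleftrightarrow> u \<in> grid_vertices m n \<and> v \<in> grid_vertices m n \<and> grid_adj u v"
proof -
  obtain a b c d where uv: "u = (a, b)" "v = (c, d)" by (cases u, cases v) auto
  show ?thesis unfolding uv
    by (auto simp: grid_edges_def horizontal_edges_def vertical_edges_def grid_vertices_def
        grid_adj_def doubleton_eq_iff)
qed

lemma horizontal_edge_iff:
  "{(i, j), (i, Suc j)} \<in> horizontal_edges m n \<longleftrightarrow> 1 \<le> i \<and> i \<le> m \<and> 1 \<le> j \<and> j < n"
proof
  assume "1 \<le> i \<and> i \<le> m \<and> 1 \<le> j \<and> j < n"
  then show "{(i, j), (i, Suc j)} \<in> horizontal_edges m n"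
    unfolding horizontal_edges_def by (intro CollectI exI[of _ i] exI[of _ j]) simp
qed (auto simp: horizontal_edges_def doubleton_eq_iff)

lemma feasible_horizontal_pair:
  assumes feas: "feasible_pair (grid_vertices m n) (grid_edges m n) T M"
    and horiz: "M \<subseteq> horizontal_edges m n"
  shows "horizontal_pair (\<lambda>i j. (i, j) \<in> T) (\<lambda>i j. {(i, j), (i, Suc j)} \<in> M)"
proof -
  let ?L = "\<lambda>i j. {(i, j), (i, Suc j)} \<in> M"
  have disj: "T \<inter> \<Union>M = {}" and T: "T \<subseteq> grid_vertices m n"
    and inj: "\<And>e f. e \<in> M \<Longrightarrow> f \<in> M \<Longrightarrow> e \<noteq> f \<Longrightarrow> e \<inter> f = {}"
    and deg: "\<And>t u v. t \<in> T \<Longrightarrow> u \<in> T \<union> \<Union>M \<Longrightarrow> v \<in> T \<union> \<Union>M \<Longrightarrow>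
      {t, u} \<in> grid_edges m n \<Longrightarrow> {t, v} \<in> grid_edges m n \<Longrightarrow> u = v"
    using feas unfolding feasible_pair_def matching_def Uniq_def by blast+
  have occ: "u \<in> T \<union> \<Union>M" if "occupied (\<lambda>i j. (i, j) \<in> T) ?L u" for u
    using that by (cases u) (auto simp: occupied_def)
  have grid: "T \<union> \<Union>M \<subseteq> grid_vertices m n"
    using T horiz grid_edges_subset[of m n] unfolding grid_edges_def by blast
  show ?thesis
  proof
    fix i j assume L: "?L i j"
    show "(i, j) \<notin> T" "(i, Suc j) \<notin> T" using L disj by auto
    have "{(i, j), (i, Suc j)} \<noteq> {(i, Suc j), (i, Suc (Suc j))}" by (auto simp: doubleton_eq_iff)
    then show "\<not> ?L i (Suc j)" using inj[OF L, of "{(i, Suc j), (i, Suc (Suc j))}"] by auto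
  next
    fix i j u v
    assume "(i, j) \<in> T" "grid_adj (i, j) u" "grid_adj (i, j) v"
      "occupied (\<lambda>i j. (i, j) \<in> T) ?L u" "occupied (\<lambda>i j. (i, j) \<in> T) ?L v"
    then show "u = v"
      using deg[of "(i, j)" u v] occ[of u] occ[of v] grid T
      by (meson grid_edge_iff subsetD)
  qed
qed

text \<open>Edges correspond to their left endpoints, and these are distinct and outside \<open>T\<close>.\<close>

lemma feasible_size_eq_weight:
  assumes feas: "feasible_pair (grid_vertices m n) (grid_edges m n) T M"
    and horiz: "M \<subseteq> horizontal_edges m n"
  shows "card T + card M = horizontal_pair.total_weight
    (\<lambda>i j. (i, j) \<in> T) (\<lambda>i j. {(i, j), (i, Suc j)} \<in> M) m n"
proof -
  let ?L = "{(i, j). {(i, j), (i, Suc j)} \<in> M}"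
  interpret horizontal_pair "\<lambda>i j. (i, j) \<in> T" "\<lambda>i j. {(i, j), (i, Suc j)} \<in> M"
    by (rule feasible_horizontal_pair[OF assms])
  have T: "T \<subseteq> grid_vertices m n" using feas by (simp add: feasible_pair_def)
  have L: "?L \<subseteq> grid_vertices m n"
  proof clarify
    fix i j assume "{(i, j), (i, Suc j)} \<in> M"
    then have "{(i, j), (i, Suc j)} \<in> horizontal_edges m n" using horiz by blast
    then show "(i, j) \<in> grid_vertices m n"
      by (simp add: horizontal_edge_iff grid_vertices_def)
  qed
  have M: "M = (\<lambda>(i, j). {(i, j), (i, Suc j)}) ` ?L"
  proof
    show "M \<subseteq> (\<lambda>(i, j). {(i, j), (i, Suc j)}) ` ?L"
    proof
      fix e assume "e \<in> M"
      moreover from this obtain i j where "e = {(i, j), (i, Suc j)}"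
        using horiz unfolding horizontal_edges_def by auto
      ultimately show "e \<in> (\<lambda>(i, j). {(i, j), (i, Suc j)}) ` ?L"
        by (intro image_eqI[of _ _ "(i, j)"]) simp_all
    qed
  qed auto
  have "inj_on (\<lambda>(i, j). {(i, j), (i, Suc j)}) ?L"
    by (auto simp: inj_on_def doubleton_eq_iff)
  then have "card M = card ?L"
    by (subst M) (rule card_image)
  moreover have "T \<inter> ?L = {}" using left_not_T by auto
  moreover have "finite T" "finite ?L"
    using T L finite_grid_vertices by (auto intro: finite_subset)
  ultimately have "card T + card M = card (T \<union> ?L)"
    by (simp only: card_Un_disjoint)
  also have "\<dots> = (\<Sum>(i, j)\<in>grid_vertices m n. weight i j)"
  proof -
    have "(\<Sum>(i, j)\<in>grid_vertices m n. weight i j) = (\<Sum>v\<in>T \<union> ?L. 1)"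
      using T L by (intro sum.mono_neutral_cong_right finite_grid_vertices)
        (auto simp: weight_def)
    then show ?thesis by simp
  qed
  also have "\<dots> = total_weight m n"
    by (simp add: total_weight_def row_weight_def grid_vertices_def sum.cartesian_product)
  finally show ?thesis .
qed

lemma horizontal_size_le:
  assumes "feasible_pair (grid_vertices m n) (grid_edges m n) T M"
    and "M \<subseteq> horizontal_edges m n"
  shows "card T + card M \<le> max (stripwise_bound m n) (stripwise_bound n m)"
proof -
  interpret horizontal_pair "\<lambda>i j. (i, j) \<in> T" "\<lambda>i j. {(i, j), (i, Suc j)} \<in> M"
    by (rule feasible_horizontal_pair[OF assms])
  have "{(i, n), (i, Suc n)} \<notin> M" for i
    using assms(2) horizontal_edge_iff[of i n m n] by auto
  then show ?thesis
    using total_weight_le feasible_size_eq_weight[OF assms] by simp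
qed

section \<open>Transposition\<close>

lemma feasible_pair_image:
  assumes "inj f" and feas: "feasible_pair V E T M"
  shows "feasible_pair (f ` V) ((`) f ` E) (f ` T) ((`) f ` M)"
proof -
  have "inj ((`) f)" using assms(1) by (simp add: inj_on_image)
  then have edge: "{f t, f u} \<in> (`) f ` E \<longleftrightarrow> {t, u} \<in> E" for t u
    using inj_image_mem_iff[of "(`) f" "{t, u}" E] by simp
  have cover: "f ` T \<union> \<Union> ((`) f ` M) = f ` (T \<union> \<Union>M)" by auto
  have "f ` e \<inter> f ` e' = {}" if "e \<in> M" "e' \<in> M" "f ` e \<noteq> f ` e'" for e e'
    using feas that unfolding feasible_pair_def matching_def
    by (metis image_Int[OF assms(1)] image_empty)
  moreover have "M \<subseteq> E"
    using feas by (simp add: feasible_pair_def matching_def)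
  ultimately have "matching ((`) f ` E) ((`) f ` M)"
    unfolding matching_def by blast
  moreover have "f ` T \<inter> \<Union> ((`) f ` M) = {}"
    using feas by (simp add: feasible_pair_def image_Int[OF assms(1), symmetric] flip: image_Union)
  moreover have "\<exists>\<^sub>\<le>\<^sub>1u. u \<in> f ` (T \<union> \<Union>M) \<and> {f t, u} \<in> (`) f ` E" if "t \<in> T" for t
  proof -
    have "\<exists>\<^sub>\<le>\<^sub>1u. u \<in> T \<union> \<Union>M \<and> {t, u} \<in> E"
      using feas that by (simp add: feasible_pair_def)
    then show ?thesis unfolding Uniq_def using edge by blast
  qed
  moreover have "f ` T \<subseteq> f ` V" using feas by (auto simp: feasible_pair_def)
  ultimately show ?thesis unfolding feasible_pair_def cover by blast
qed

lemma swap_grid_vertices: "prod.swap ` grid_vertices n m = grid_vertices m n"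
  by (auto simp: grid_vertices_def)

lemma swap_horizontal_edges: "(`) prod.swap ` horizontal_edges n m = vertical_edges m n"
proof (rule set_eqI, rule iffI)
  fix e assume "e \<in> vertical_edges m n"
  then obtain i j where "e = {(i, j), (i + 1, j)}" "1 \<le> i" "i + 1 \<le> m" "1 \<le> j" "j \<le> n"
    by (auto simp: vertical_edges_def)
  then have "e = prod.swap ` {(j, i), (j, i + 1)}" "{(j, i), (j, i + 1)} \<in> horizontal_edges n m"
    by (auto simp: horizontal_edges_def)
  then show "e \<in> (`) prod.swap ` horizontal_edges n m" by blast
next
  fix e assume "e \<in> (`) prod.swap ` horizontal_edges n m"
  then obtain i j where "e = {(j, i), (j + 1, i)}" "1 \<le> i" "i \<le> n" "1 \<le> j" "j + 1 \<le> m"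
    by (auto simp: horizontal_edges_def)
  then show "e \<in> vertical_edges m n"
    unfolding vertical_edges_def by blast
qed

lemma swap_vertical_edges: "(`) prod.swap ` vertical_edges n m = horizontal_edges m n"
  by (simp add: image_image flip: swap_horizontal_edges)

lemma swap_grid_edges: "(`) prod.swap ` grid_edges n m = grid_edges m n"
  by (auto simp: grid_edges_def image_Un swap_horizontal_edges swap_vertical_edges)

lemma feasible_pair_swap:
  assumes "feasible_pair (grid_vertices n m) (grid_edges n m) T M"
  shows "feasible_pair (grid_vertices m n) (grid_edges m n)
    (prod.swap ` T) ((`) prod.swap ` M)"
  using feasible_pair_image[OF inj_swap assms]
  by (simp add: swap_grid_vertices swap_grid_edges)

lemma card_swap_image: "card (prod.swap ` T) = card T" "card ((`) prod.swap ` M) = card M"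
  by (simp_all add: card_image inj_on_image)

lemma vertical_size_le:
  assumes feas: "feasible_pair (grid_vertices m n) (grid_edges m n) T M"
    and vert: "M \<subseteq> vertical_edges m n"
  shows "card T + card M \<le> max (stripwise_bound m n) (stripwise_bound n m)"
proof -
  have "(`) prod.swap ` M \<subseteq> horizontal_edges n m"
    using image_mono[OF vert, of "(`) prod.swap"] by (simp add: swap_vertical_edges)
  from horizontal_size_le[OF feasible_pair_swap[OF feas] this]
  show ?thesis by (simp add: card_swap_image max.commute)
qed

section \<open>An optimal vertex set\<close>

text \<open>
  Odd rows read \<open>T T . T T .\<close> and even rows \<open>. . T . . T\<close>. Vertical neighbours never both belong
  to the set, and of three consecutive cells in a row at most two do.
\<close>

definition brick_set :: "nat \<Rightarrow> nat \<Rightarrow> (nat \<times> nat) set" where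
  "brick_set m n = {(i, j) \<in> grid_vertices m n. odd i \<longleftrightarrow> \<not> 3 dvd j}"

lemma brick_set_feasible:
  "feasible_pair (grid_vertices m n) (grid_edges m n) (brick_set m n) {}"
proof -
  have "u = v" if t: "t \<in> brick_set m n" and "u \<in> brick_set m n" "v \<in> brick_set m n"
    "{t, u} \<in> grid_edges m n" "{t, v} \<in> grid_edges m n" for t u v
  proof -
    obtain a b where ab: "t = (a, b)" by (cases t)
    \<comment> \<open>A vertical neighbour has the other row parity but the same column, so it is not in the set.\<close>
    have near: "x = (a, b - 1) \<and> (3 dvd b - 1 \<longleftrightarrow> 3 dvd b) \<or> x = (a, b + 1) \<and> (3 dvd b + 1 \<longleftrightarrow> 3 dvd b)"
      if "x \<in> brick_set m n" "{t, x} \<in> grid_edges m n" for x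
    proof -
      have "grid_adj t x" using that(2) by (simp add: grid_edge_iff)
      moreover have "odd (fst x) \<longleftrightarrow> \<not> 3 dvd snd x" "odd a \<longleftrightarrow> \<not> 3 dvd b"
        using that(1) t by (auto simp: brick_set_def ab)
      ultimately show ?thesis
        by (cases x) (auto simp: grid_adj_def ab)
    qed
    \<comment> \<open>Of three consecutive numbers, exactly one is divisible by 3.\<close>
    have "b \<noteq> 0" using t by (auto simp: brick_set_def grid_vertices_def ab)
    then have "\<not> ((3 dvd b - 1 \<longleftrightarrow> 3 dvd b) \<and> (3 dvd b + 1 \<longleftrightarrow> 3 dvd b))"
      by presburger
    then show ?thesis
      using near[OF that(2,4)] near[OF that(3,5)] by blast
  qed
  then show ?thesis
    by (auto simp: feasible_pair_def matching_def Uniq_def brick_set_def)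
qed

lemma card_filter_Suc:
  "card {j \<in> {1..Suc n}. P j} = card {j \<in> {1..n}. P j} + of_bool (P (Suc n))"
proof -
  have "{j \<in> {1..Suc n}. P j} =
      (if P (Suc n) then insert (Suc n) {j \<in> {1..n}. P j} else {j \<in> {1..n}. P j})"
    by (auto simp: le_Suc_eq)
  then show ?thesis by simp
qed

lemma card_odd: "card {i \<in> {1..n}. odd i} = (n + 1) div 2"
proof (induction n)
  case (Suc n)
  show ?case
    unfolding card_filter_Suc Suc.IH by (cases "odd (Suc n)"; simp only: of_bool_eq simp_thms; presburger)
qed simp

lemma card_multiples_of_3: "card {j \<in> {1..n}. 3 dvd j} = n div 3"
proof (induction n)
  case (Suc n)
  show ?case
    unfolding card_filter_Suc Suc.IH by (cases "3 dvd Suc n"; simp only: of_bool_eq simp_thms; presburger)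
qed simp

lemma card_filter_not: "card {j \<in> {1..n}. \<not> P j} = n - card {j \<in> {1..n}. P j}"
proof -
  have "card ({1..n} - {j \<in> {1..n}. P j}) = card {1..n} - card {j \<in> {1..n}. P j}"
    by (rule card_Diff_subset) auto
  moreover have "{1..n} - {j \<in> {1..n}. P j} = {j \<in> {1..n}. \<not> P j}" by blast
  ultimately show ?thesis by simp
qed

lemma card_brick_set:
  "card (brick_set m n) = ((m + 1) div 2) * (n - n div 3) + (m div 2) * (n div 3)"
proof -
  let ?O = "{i \<in> {1..m}. odd i}" and ?E = "{i \<in> {1..m}. \<not> odd i}"
  let ?D = "{j \<in> {1..n}. 3 dvd j}" and ?N = "{j \<in> {1..n}. \<not> 3 dvd j}"
  have "brick_set m n = ?O \<times> ?N \<union> ?E \<times> ?D"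
    by (auto simp: brick_set_def grid_vertices_def)
  then have "card (brick_set m n) = card (?O \<times> ?N) + card (?E \<times> ?D)"
    by (simp add: card_Un_disjoint disjoint_iff)
  also have "\<dots> = ((m + 1) div 2) * (n - n div 3) + (m - (m + 1) div 2) * (n div 3)"
    unfolding card_cartesian_product card_filter_not[of m odd] card_filter_not[of n "(dvd) 3"]
      card_odd card_multiples_of_3 ..
  also have "m - (m + 1) div 2 = m div 2" by presburger
  finally show ?thesis .
qed

lemma card_brick_set_eq_bound: "card (brick_set m n) = stripwise_bound m n"
proof -
  let ?q = "m div 2" and ?t = "n div 3"
  have third: "(2 * n + 2) div 3 = n - ?t" "?t \<le> n" by presburger+
  have pair: "?q * (n - ?t) + ?q * ?t = ?q * n"
    using third(2) by (simp flip: distrib_left)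
  show ?thesis
  proof (cases "even m")
    case True
    then have "(m + 1) div 2 = ?q" by presburger
    then show ?thesis
      using True pair by (simp only: card_brick_set stripwise_bound_def if_False simp_thms)
  next
    case False
    then have "(m + 1) div 2 = Suc ?q" by presburger
    then show ?thesis
      using False pair third(1)
      by (simp only: card_brick_set stripwise_bound_def if_True simp_thms mult_Suc)
  qed
qed

section \<open>The maximum\<close>

lemma half_thirds_eq_bound:
  "\<lceil>real m / 2\<rceil> * \<lceil>2 * real n / 3\<rceil> + \<lfloor>real m / 2\<rfloor> * \<lfloor>real n / 3\<rfloor> = int (stripwise_bound m n)"
proof -
  have "\<lceil>real m / 2\<rceil> = int ((m + 1) div 2)" by linarith
  moreover have "\<lceil>2 * real n / 3\<rceil> = int (n - n div 3)" by linarith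
  moreover have "\<lfloor>real m / 2\<rfloor> = int (m div 2)" by linarith
  moreover have "\<lfloor>real n / 3\<rfloor> = int (n div 3)" by linarith
  ultimately show ?thesis
    by (simp flip: card_brick_set_eq_bound add: card_brick_set)
qed

lemma F_eq_bound: "F m n = int (max (stripwise_bound m n) (stripwise_bound n m))"
  by (simp add: F_def half_thirds_eq_bound)

lemma bound_attained:
  obtains T where "feasible_pair (grid_vertices m n) (grid_edges m n) T {}"
    and "card T = max (stripwise_bound m n) (stripwise_bound n m)"
proof (cases "stripwise_bound n m \<le> stripwise_bound m n")
  case True
  then show ?thesis
    using that[OF brick_set_feasible] by (simp add: card_brick_set_eq_bound)
next
  case False
  then show ?thesis
    using that[of "prod.swap ` brick_set n m"] feasible_pair_swap[OF brick_set_feasible[of n m]]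
    by (simp add: card_brick_set_eq_bound card_swap_image)
qed

text \<open>
  The optimum is reached with the empty matching, so it is the same for every restriction \<open>P\<close> on
  matchings that admits the empty one and keeps to the upper bound.
\<close>

lemma Max_feasible_sizes:
  assumes "P {}"
    and "\<And>T M. feasible_pair (grid_vertices m n) (grid_edges m n) T M \<Longrightarrow> P M \<Longrightarrow>
      card T + card M \<le> max (stripwise_bound m n) (stripwise_bound n m)"
  shows "int (Max {card T + card M | T M.
      feasible_pair (grid_vertices m n) (grid_edges m n) T M \<and> P M}) = F m n"
proof -
  obtain T where "feasible_pair (grid_vertices m n) (grid_edges m n) T {}"
    and "card T = max (stripwise_bound m n) (stripwise_bound n m)"
    by (rule bound_attained)
  with assms(1) have "max (stripwise_bound m n) (stripwise_bound n m) \<in> {card T + card M | T M.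
      feasible_pair (grid_vertices m n) (grid_edges m n) T M \<and> P M}"
    by (intro CollectI exI[of _ T] exI[of _ "{}"]) simp
  then have "Max {card T + card M | T M.
      feasible_pair (grid_vertices m n) (grid_edges m n) T M \<and> P M}
    = max (stripwise_bound m n) (stripwise_bound n m)"
    using assms(2) by (intro Max_eqI finite_feasible_sizes) blast+
  then show ?thesis by (simp add: F_eq_bound)
qed

theorem theorem5p4:
  fixes m n :: nat
  assumes "m \<ge> 1" and "n \<ge> 1"
  shows "int (Omega_H m n) = F m n \<and> int (Omega_V m n) = F m n"
  unfolding Omega_H_def Omega_V_def
  using Max_feasible_sizes[of "\<lambda>M. M \<subseteq> horizontal_edges m n", OF _ horizontal_size_le]
    Max_feasible_sizes[of "\<lambda>M. M \<subseteq> vertical_edges m n", OF _ vertical_size_le]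
  by simp

end
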